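(* Let $\lambda=(\gamma_0,c_0)\in C_3$ have coordinates $(\varphi,k)$ with $k=1$, let $s_1=\mathrm{sgn}(\cos(\gamma_0/2))$, $s_2=\mathrm{sgn}(c_0)$, and put $\varphi_t=\varphi+t$ and $w=\cosh\varphi$. Then the extremal trajectory $q_t=(x_t,y_t,z_t)$ with initial covector $\lambda$ and $q_0=(0,0,0)$ is given, for all $t\ge0$, by $$x_t=\frac{s_1}{2}\left[\frac1w(\varphi_t-\varphi)+w(\tanh\varphi_t-\tanh\varphi)\right],$$ $$y_t=\frac{s_2}{2}\left[\frac1w(\varphi_t-\varphi)-w(\tanh\varphi_t-\tanh\varphi)\right],$$ $$z_t=-s_1s_2\ln\left[w\,\mathrm{sech}\,\varphi_t\right].$$
   Context: Setting: $M=\mathrm{SH}(2)$ is the Lie group of matrices $\begin{pmatrix}\cosh z&\sinh z&x\\ \sinh z&\cosh z&y\\0&0&1\end{pmatrix}$, identified with $\mathbb{R}^3$ via $(x,y,z)$ (identity $=(0,0,0)$), with the left-invariant sub-Riemannian structure having orthonormal frame $f_1=\cosh z\,\partial_x+\sinh z\,\partial_y$, $f_2=\partial_z$. Its arc-length parametrized normal extremals starting at the identity, given by the Pontryagin Maximum Principle, are described as follows. The phase cylinder is $C=(\mathbb{R}/4\pi\mathbb{Z})\times\mathbb{R}\ni(\gamma,c)$. For $\lambda=(\gamma_0,c_0)\in C$, let $(\gamma_t,c_t,x_t,y_t,z_t)$ solve $$\dot\gamma=c,\quad \dot c=-\sin\gamma,\quad \dot x=\cos\tfrac{\gamma}{2}\cosh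 z,\quad \dot y=\cos\tfrac{\gamma}{2}\sinh z,\quad \dot z=\sin\tfrac{\gamma}{2},$$ with initial values $(\gamma_0,c_0)$ and $x_0=y_0=z_0=0$. The curve $q_t=(x_t,y_t,z_t)$ is the extremal trajectory with initial covector $\lambda$. The pendulum energy is $E=\frac{c^2}{2}-\cos\gamma$, and $C_3=\{(\gamma,c)\in C: E=1,\ c\ne0\}$. Coordinates $(\varphi,k)$ on $C_3$: $k=1$ and $\varphi\in\mathbb{R}$ is determined by $\sin\frac{\gamma}{2}=s_1s_2\tanh\varphi$, $\cos\frac{\gamma}{2}=s_1/\cosh\varphi$, $\frac{c}{2}=s_2/\cosh\varphi$, where $s_1=\mathrm{sgn}(\cos\frac{\gamma}{2})$ and $s_2=\mathrm{sgn}(c)$. *)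

theory Defs
  imports Complex_Main
begin

(* The circle R / 4 pi Z; the half-angle functions are well defined on it. *)
quotient_type angle = real / "\<lambda>a b. \<exists>n::int. a - b = 4 * pi * of_int n"
  morphisms rep_angle angle_of
proof (rule equivpI)
  show "reflp (\<lambda>a b. \<exists>n::int. a - b = 4 * pi * of_int n)"
    by (rule reflpI) (rule exI[of _ 0], simp)
  show "symp (\<lambda>a b. \<exists>n::int. a - b = 4 * pi * of_int n)"
  proof (rule sympI)
    fix a b :: real assume "\<exists>n::int. a - b = 4 * pi * of_int n"
    then obtain n :: int where "a - b = 4 * pi * of_int n" ..
    then have "b - a = 4 * pi * of_int (- n)" by simp
    then show "\<exists>n::int. b - a = 4 * pi * of_int n" ..
  qed
  show "transp (\<lambda>a b. \<exists>n::int. a - b = 4 * pi * of_int n)"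
  proof (rule transpI)
    fix a b c :: real
    assume "\<exists>n::int. a - b = 4 * pi * of_int n" "\<exists>n::int. b - c = 4 * pi * of_int n"
    then obtain m n :: int where "a - b = 4 * pi * of_int m" "b - c = 4 * pi * of_int n" by blast
    then have "a - c = 4 * pi * of_int (m + n)" by (simp add: algebra_simps)
    then show "\<exists>n::int. a - c = 4 * pi * of_int n" ..
  qed
qed

lemma sin_cos_add_period:
  fixes a b :: real and n :: int
  assumes "a - b = 4 * pi * of_int n"
  shows "sin a = sin b" "cos a = cos b" "sin (a / 2) = sin (b / 2)" "cos (a / 2) = cos (b / 2)"
proof -
  have a: "a = b + of_int (2 * n) * (2 * pi)" and h: "a / 2 = b / 2 + of_int n * (2 * pi)"
    using assms by (simp_all add: field_simps)
  show "sin a = sin b" "cos a = cos b"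
    unfolding a sin_add cos_add by (simp_all only: sin_int_2pin cos_int_2pin mult.commute[of _ "2 * pi"], (simp_all)?)
  show "sin (a / 2) = sin (b / 2)" "cos (a / 2) = cos (b / 2)"
    unfolding h sin_add cos_add by (simp_all only: sin_int_2pin cos_int_2pin mult.commute[of _ "2 * pi"], (simp_all)?)
qed

lift_definition sin_angle :: "angle \<Rightarrow> real" is "\<lambda>a. sin a"
  by (auto dest: sin_cos_add_period)
lift_definition cos_angle :: "angle \<Rightarrow> real" is "\<lambda>a. cos a"
  by (auto dest: sin_cos_add_period)
lift_definition sin_half :: "angle \<Rightarrow> real" is "\<lambda>a. sin (a / 2)"
  by (auto dest: sin_cos_add_period)
lift_definition cos_half :: "angle \<Rightarrow> real" is "\<lambda>a. cos (a / 2)"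
  by (auto dest: sin_cos_add_period)

(* The derivative of a curve on the circle is that of a local real-valued lift;
   it does not depend on the choice of the lift. *)
definition has_angle_derivative ::
    "(real \<Rightarrow> angle) \<Rightarrow> real \<Rightarrow> real \<Rightarrow> real set \<Rightarrow> bool" where
  "has_angle_derivative \<gamma> v t S \<longleftrightarrow>
     (\<exists>g. \<gamma> t = angle_of (g t) \<and> (\<forall>\<^sub>F s in at t within S. \<gamma> s = angle_of (g s)) \<and>
          (g has_real_derivative v) (at t within S))"

type_synonym phase_point = "angle \<times> real"

definition pendulum_energy :: "phase_point \<Rightarrow> real" where
  "pendulum_energy = (\<lambda>(\<gamma>, c). c\<^sup>2 / 2 - cos_angle \<gamma>)"

definition C3 :: "phase_point set" where
  "C3 = {(\<gamma>, c). pendulum_energy (\<gamma>, c) = 1 \<and> c \<noteq> 0}"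

definition has_C3_coordinates :: "phase_point \<Rightarrow> real \<Rightarrow> real \<Rightarrow> bool" where
  "has_C3_coordinates = (\<lambda>(\<gamma>, c) \<phi> k.
     let s\<^sub>1 = sgn (cos_half \<gamma>); s\<^sub>2 = sgn c in
       k = 1 \<and>
       sin_half \<gamma> = s\<^sub>1 * s\<^sub>2 * tanh \<phi> \<and>
       cos_half \<gamma> = s\<^sub>1 / cosh \<phi> \<and>
       c / 2 = s\<^sub>2 / cosh \<phi>)"

lemma C3_coordinates_ex1:
  assumes "(\<gamma>, c) \<in> C3"
  shows "\<exists>!\<phi>. has_C3_coordinates (\<gamma>, c) \<phi> 1"
proof -
  define A S where "A = cos_half \<gamma>" and "S = sin_half \<gamma>"
  have AS: "A\<^sup>2 + S\<^sup>2 = 1" unfolding A_def S_def by transfer simp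
  have "cos_angle \<gamma> = 2 * A\<^sup>2 - 1"
    unfolding A_def by transfer (metis cos_double_cos mult_2 field_sum_of_halves)
  with assms have c: "c\<^sup>2 = (2 * A)\<^sup>2" "c \<noteq> 0"
    by (auto simp: C3_def pendulum_energy_def power_mult_distrib)
  then have A0: "A \<noteq> 0" by auto
  from c(1) have cA: "\<bar>c\<bar> = 2 * \<bar>A\<bar>"
    by (simp only: power2_eq_iff) (auto simp: abs_mult)
  have sq: "(sgn A * sgn c)\<^sup>2 = 1" using A0 c by (simp add: power_mult_distrib sgn_if)
  have coords: "has_C3_coordinates (\<gamma>, c) \<phi> 1 \<longleftrightarrow> sinh \<phi> = sgn A * sgn c * S / \<bar>A\<bar>"
    (is "?L \<longleftrightarrow> ?R") for \<phi>
  proof -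
    have L: "?L \<longleftrightarrow> S = sgn A * sgn c * tanh \<phi> \<and> cosh \<phi> = 1 / \<bar>A\<bar>"
    proof -
      have "A = sgn A * \<bar>A\<bar>" "c / 2 = sgn c * \<bar>A\<bar>"
        using cA by (auto simp: sgn_mult_abs abs_if sgn_if split: if_splits)
      then have "A = sgn A / cosh \<phi> \<longleftrightarrow> \<bar>A\<bar> = 1 / cosh \<phi>"
        "c / 2 = sgn c / cosh \<phi> \<longleftrightarrow> \<bar>A\<bar> = 1 / cosh \<phi>"
        using A0 c(2) by (metis mult_cancel_left sgn_zero_iff times_divide_eq_right mult.right_neutral)+
      moreover have "\<bar>A\<bar> = 1 / cosh \<phi> \<longleftrightarrow> cosh \<phi> = 1 / \<bar>A\<bar>"
        using A0 cosh_real_pos[of \<phi>] by (auto simp: field_simps)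
      ultimately show ?thesis
        by (simp add: has_C3_coordinates_def Let_def A_def[symmetric] S_def[symmetric])
    qed
    show ?thesis
    proof
      assume ?L
      then have S: "S = sgn A * sgn c * tanh \<phi>" and ch: "cosh \<phi> = 1 / \<bar>A\<bar>" unfolding L by auto
      have "tanh \<phi> = sinh \<phi> * \<bar>A\<bar>" unfolding tanh_def ch by simp
      then have "sgn A * sgn c * S / \<bar>A\<bar> = (sgn A * sgn c)\<^sup>2 * sinh \<phi>"
        unfolding S using A0 by (simp add: power2_eq_square)
      then show ?R unfolding sq by simp
    next
      assume R: ?R
      have "(cosh \<phi>)\<^sup>2 = 1 + S\<^sup>2 / A\<^sup>2"
        unfolding cosh_square_eq R using sq by (simp add: power_mult_distrib power_divide)
      also have "\<dots> = (1 / \<bar>A\<bar>)\<^sup>2" using AS A0 by (simp add: field_simps)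
      finally have "cosh \<phi> = 1 / \<bar>A\<bar>"
        by (rule power2_eq_imp_eq) (simp_all add: cosh_real_nonneg)
      moreover from this have "sgn A * sgn c * tanh \<phi> = (sgn A * sgn c)\<^sup>2 * S"
        unfolding tanh_def R using A0 by (simp add: power2_eq_square)
      ultimately show ?L unfolding L sq by simp
    qed
  qed
  show ?thesis unfolding coords
    by (metis arsinh_sinh_real sinh_arsinh_real)
qed

(* Points of SH(2) are written in the global coordinates (x, y, z), and time runs over [0, \<infinity>):
   at t = 0 the derivatives are one-sided and q is unconstrained at negative times. *)
definition extremal_trajectory ::
    "phase_point \<Rightarrow> (real \<Rightarrow> real \<times> real \<times> real) \<Rightarrow> bool" where
  "extremal_trajectory p q \<longleftrightarrow>
     (\<exists>\<gamma> c x y z.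
        (\<gamma> 0, c 0) = p \<and> x 0 = 0 \<and> y 0 = 0 \<and> z 0 = 0 \<and>
        (\<forall>t\<ge>0. q t = (x t, y t, z t) \<and>
           has_angle_derivative \<gamma> (c t) t {0..} \<and>
           (c has_real_derivative - sin_angle (\<gamma> t)) (at t within {0..}) \<and>
           (x has_real_derivative cos_half (\<gamma> t) * cosh (z t)) (at t within {0..}) \<and>
           (y has_real_derivative cos_half (\<gamma> t) * sinh (z t)) (at t within {0..}) \<and>
           (z has_real_derivative sin_half (\<gamma> t)) (at t within {0..})))"

end

theory Submission
  imports Defs "HOL-Analysis.Derivative"
begin

text \<open>
  On \<open>C3\<close> the initial covector satisfies \<open>c / 2 = \<sigma> cos (\<gamma> / 2)\<close> with the sign
  \<open>\<sigma> = s\<^sub>1 s\<^sub>2\<close>.  This relation cuts out one branch of the level set \<open>E = 1\<close>, which consists of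
  separatrices and unstable equilibria of the pendulum, and everything rests on the fact that it
  is preserved along any solution: the defect \<open>u = c / 2 - \<sigma> cos (\<gamma> / 2)\<close> satisfies the
  linear equation \<open>u' = \<sigma> sin (\<gamma> / 2) u\<close>, and since \<open>z' = sin (\<gamma> / 2)\<close>, the coordinate \<open>z\<close> of the
  trajectory itself supplies the integrating factor \<open>exp (- \<sigma> z)\<close>.

  On the separatrix the system can be integrated through \<open>exp (\<sigma> z)\<close>: the products
  \<open>exp (\<sigma> z) (1 + \<sigma> sin (\<gamma> / 2))\<close> and \<open>exp (\<sigma> z) (1 - \<sigma> sin (\<gamma> / 2))\<close> are proportional to
  \<open>exp t\<close> and \<open>exp (- t)\<close>, so that their mean is \<open>exp (\<sigma> z) = cosh (\<phi> + t) / cosh \<phi>\<close>.  Moreover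
  \<open>cos (\<gamma> / 2) exp (\<sigma> z)\<close> is constant.  Hence \<open>z\<close> and \<open>cos (\<gamma> / 2)\<close> are explicit, and so are
  the derivatives of \<open>x\<close> and \<open>y\<close>; they agree with those of the stated formulas.  Uniqueness thus
  comes from the mean value theorem: every step exhibits a quantity whose derivative vanishes.

  Conversely, the stated curve is an extremal trajectory because the vertical part of the system
  is solved by the real lift \<open>g\<^sub>0 + 2 s\<^sub>2 (arctan (sinh (\<phi> + t)) - arctan (sinh \<phi>))\<close> of the
  angle, where \<open>g\<^sub>0\<close> represents the initial angle: the Gudermannian function
  \<open>arctan (sinh r)\<close> has cosine \<open>1 / cosh r\<close>, sine \<open>tanh r\<close> and derivative \<open>1 / cosh r\<close>.
\<close>

section \<open>Functions with equal derivatives\<close>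

lemma eq_if_derivatives_eq:
  fixes f g f' :: "real \<Rightarrow> real"
  assumes "\<And>t. t \<ge> 0 \<Longrightarrow> (f has_real_derivative f' t) (at t within {0..})"
    and "\<And>t. t \<ge> 0 \<Longrightarrow> (g has_real_derivative f' t) (at t within {0..})"
    and "f 0 = g 0" "t \<ge> 0"
  shows "f t = g t"
proof -
  have "\<exists>d. \<forall>t\<in>{0..}. f t - g t = d"
  proof (rule has_field_derivative_zero_constant)
    fix t :: real assume "t \<in> {0..}"
    then show "((\<lambda>t. f t - g t) has_real_derivative 0) (at t within {0..})"
      using DERIV_diff[OF assms(1)[of t] assms(2)[of t]] by simp
  qed simp
  then show ?thesis
    using assms(3,4) by (metis atLeast_iff diff_self eq_iff_diff_eq_0 order_refl)
qed

text \<open>The integrating factor \<open>exp (- h)\<close> makes the linear equation \<open>f' = h' f\<close> explicitly solvable.\<close>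

lemma linear_ode_solution:
  fixes f h h' :: "real \<Rightarrow> real"
  assumes f: "\<And>t. t \<ge> 0 \<Longrightarrow> (f has_real_derivative h' t * f t) (at t within {0..})"
    and h: "\<And>t. t \<ge> 0 \<Longrightarrow> (h has_real_derivative h' t) (at t within {0..})"
    and "h 0 = 0" "t \<ge> 0"
  shows "f t = f 0 * exp (h t)"
proof -
  have "f t * exp (- h t) = f 0"
  proof (rule eq_if_derivatives_eq[where f = "\<lambda>t. f t * exp (- h t)" and f' = "\<lambda>_. 0"])
    fix t :: real assume "t \<ge> 0"
    show "((\<lambda>t. f t * exp (- h t)) has_real_derivative 0) (at t within {0..})"
      by (rule derivative_eq_intros f h \<open>t \<ge> 0\<close> refl)+ (simp add: algebra_simps)
  qed (use assms in auto)
  then show ?thesis by (simp add: exp_minus field_simps)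
qed

section \<open>Half angles along a curve on the circle\<close>

lemma sin_half_squared_add_cos_half_squared: "(sin_half a)\<^sup>2 + (cos_half a)\<^sup>2 = 1"
  by transfer simp

lemma sin_angle_double: "sin_angle a = 2 * sin_half a * cos_half a"
  by transfer (metis sin_double mult_2 field_sum_of_halves)

lemma cos_angle_double: "cos_angle a = 2 * (cos_half a)\<^sup>2 - 1"
  by transfer (metis cos_double_cos mult_2 field_sum_of_halves)

lemma has_angle_derivative_half_angles:
  assumes "has_angle_derivative \<gamma> v t S" "t \<in> S"
  shows "((\<lambda>t. sin_half (\<gamma> t)) has_real_derivative cos_half (\<gamma> t) * v / 2) (at t within S)"
    and "((\<lambda>t. cos_half (\<gamma> t)) has_real_derivative - sin_half (\<gamma> t) * v / 2) (at t within S)"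
proof -
  obtain g where at: "\<gamma> t = angle_of (g t)"
    and near: "\<forall>\<^sub>F s in at t within S. \<gamma> s = angle_of (g s)"
    and g: "(g has_real_derivative v) (at t within S)"
    using assms(1) unfolding has_angle_derivative_def by blast
  have transform: "((\<lambda>s. f (\<gamma> s)) has_real_derivative d) (at t within S)"
    if "((\<lambda>s. f (angle_of (g s))) has_real_derivative d) (at t within S)" for f :: "angle \<Rightarrow> real" and d
    using that unfolding has_field_derivative_def
    by (rule has_derivative_transform_eventually)
       (use near at assms(2) in \<open>auto elim: eventually_mono\<close>)
  show "((\<lambda>t. sin_half (\<gamma> t)) has_real_derivative cos_half (\<gamma> t) * v / 2) (at t within S)"
    by (rule transform, unfold at sin_half.abs_eq cos_half.abs_eq)
       (rule derivative_eq_intros g refl | simp)+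
  show "((\<lambda>t. cos_half (\<gamma> t)) has_real_derivative - sin_half (\<gamma> t) * v / 2) (at t within S)"
    by (rule transform, unfold at sin_half.abs_eq cos_half.abs_eq)
       (rule derivative_eq_intros g refl | simp)+
qed

text \<open>
  The nonvanishing of \<open>c\<close> on \<open>C3\<close> forces that of \<open>cos (\<gamma> / 2)\<close>: the energy is \<open>1\<close> exactly when
  \<open>c\<^sup>2 = 4 cos\<^sup>2 (\<gamma> / 2)\<close>.  So both signs in the coordinate system are genuine signs.
\<close>

lemma cos_half_nonzero_on_C3:
  assumes "(\<gamma>, c) \<in> C3"
  shows "cos_half \<gamma> \<noteq> 0"
  using assms by (auto simp: C3_def pendulum_energy_def cos_angle_double)

section \<open>The explicit curve\<close>

definition separatrix_x :: "real \<Rightarrow> real \<Rightarrow> real \<Rightarrow> real" where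
  "separatrix_x s\<^sub>1 \<phi> t = s\<^sub>1 / 2 * (t / cosh \<phi> + cosh \<phi> * (tanh (\<phi> + t) - tanh \<phi>))"

definition separatrix_y :: "real \<Rightarrow> real \<Rightarrow> real \<Rightarrow> real" where
  "separatrix_y s\<^sub>2 \<phi> t = s\<^sub>2 / 2 * (t / cosh \<phi> - cosh \<phi> * (tanh (\<phi> + t) - tanh \<phi>))"

definition separatrix_z :: "real \<Rightarrow> real \<Rightarrow> real \<Rightarrow> real" where
  "separatrix_z \<sigma> \<phi> t = \<sigma> * ln (cosh (\<phi> + t) / cosh \<phi>)"

lemma separatrix_at_0 [simp]:
  "separatrix_x s\<^sub>1 \<phi> 0 = 0" "separatrix_y s\<^sub>2 \<phi> 0 = 0" "separatrix_z \<sigma> \<phi> 0 = 0"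
  by (simp_all add: separatrix_x_def separatrix_y_def separatrix_z_def)

lemma tanh_has_derivative_sech_squared:
  fixes r :: real
  shows "((\<lambda>t. tanh (r + t)) has_real_derivative 1 / (cosh (r + t))\<^sup>2) (at t within S)"
proof -
  have "1 - (tanh (r + t))\<^sup>2 = 1 / (cosh (r + t))\<^sup>2"
    using cosh_square_eq[of "r + t"]
    by (simp add: tanh_def power_divide divide_simps add_nonneg_eq_0_iff)
  then show ?thesis by (auto intro!: derivative_eq_intros)
qed

lemma separatrix_z_derivative:
  "(separatrix_z \<sigma> \<phi> has_real_derivative \<sigma> * tanh (\<phi> + t)) (at t within S)"
  unfolding separatrix_z_def
  by (auto intro!: derivative_eq_intros simp: tanh_def cosh_real_pos)

lemma separatrix_x_derivative:
  assumes "\<bar>\<sigma>\<bar> = 1"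
  shows "(separatrix_x s\<^sub>1 \<phi> has_real_derivative
           s\<^sub>1 / cosh (\<phi> + t) * cosh (separatrix_z \<sigma> \<phi> t)) (at t within S)"
proof -
  have "cosh (separatrix_z \<sigma> \<phi> t) = cosh (ln (cosh (\<phi> + t) / cosh \<phi>))"
    using assms by (auto simp: separatrix_z_def abs_if split: if_splits)
  also have "\<dots> = (cosh (\<phi> + t) / cosh \<phi> + cosh \<phi> / cosh (\<phi> + t)) / 2"
    by (simp add: cosh_ln_real cosh_real_pos)
  finally have c: "cosh (separatrix_z \<sigma> \<phi> t) = \<dots>" .
  show ?thesis
    unfolding c separatrix_x_def
    by (rule derivative_eq_intros tanh_has_derivative_sech_squared refl | simp)+
       (simp add: field_simps power2_eq_square)
qed

lemma separatrix_y_derivative: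
  assumes "\<bar>s\<^sub>1\<bar> = 1" "\<bar>s\<^sub>2\<bar> = 1"
  shows "(separatrix_y s\<^sub>2 \<phi> has_real_derivative
           s\<^sub>1 / cosh (\<phi> + t) * sinh (separatrix_z (s\<^sub>1 * s\<^sub>2) \<phi> t)) (at t within S)"
proof -
  have "s\<^sub>1 * sinh (separatrix_z (s\<^sub>1 * s\<^sub>2) \<phi> t) = s\<^sub>2 * sinh (ln (cosh (\<phi> + t) / cosh \<phi>))"
    using assms by (auto simp: separatrix_z_def abs_if split: if_splits)
  also have "\<dots> = s\<^sub>2 * ((cosh (\<phi> + t) / cosh \<phi> - cosh \<phi> / cosh (\<phi> + t)) / 2)"
    by (simp add: sinh_ln_real cosh_real_pos)
  finally have c: "s\<^sub>1 / cosh (\<phi> + t) * sinh (separatrix_z (s\<^sub>1 * s\<^sub>2) \<phi> t) = \<dots> / cosh (\<phi> + t)"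
    by (simp only: times_divide_eq_left)
  show ?thesis
    unfolding c separatrix_y_def
    by (rule derivative_eq_intros tanh_has_derivative_sech_squared refl | simp)+
       (simp add: field_simps power2_eq_square)
qed

section \<open>Existence: a lift of the vertical motion\<close>

lemma
  fixes r :: real
  shows cos_arctan_sinh: "cos (arctan (sinh r)) = 1 / cosh r"
    and sin_arctan_sinh: "sin (arctan (sinh r)) = tanh r"
proof -
  have "sqrt (1 + (sinh r)\<^sup>2) = cosh r"
    using cosh_square_eq[of r] by (metis add.commute cosh_real_nonneg real_sqrt_unique)
  then show "cos (arctan (sinh r)) = 1 / cosh r" "sin (arctan (sinh r)) = tanh r"
    by (simp_all add: cos_arctan sin_arctan tanh_def)
qed

lemma arctan_sinh_derivative:
  "((\<lambda>t. arctan (sinh (\<phi> + t))) has_real_derivative 1 / cosh (\<phi> + t)) (at t within S)"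
proof -
  have "1 + (sinh (\<phi> + t))\<^sup>2 = (cosh (\<phi> + t))\<^sup>2" by (simp add: cosh_square_eq)
  then show ?thesis
    by (auto intro!: derivative_eq_intros simp: power2_eq_square field_simps)
qed

text \<open>
  Rotating the initial half angle by the increment of the Gudermannian moves it along the
  separatrix.  Working with increments from an arbitrary lift \<open>g\<^sub>0\<close> covers both signs
  \<open>s\<^sub>1\<close> at once: a half angle with coordinates \<open>(s\<^sub>1, s\<^sub>2, \<phi>)\<close> differs from
  \<open>s\<^sub>2 arctan (sinh \<phi>)\<close> by a rotation through \<open>0\<close> or \<open>pi\<close>.
\<close>

lemma half_angle_of_lift:
  fixes g\<^sub>0 \<phi> r s\<^sub>1 s\<^sub>2 :: real
  assumes s: "\<bar>s\<^sub>2\<bar> = 1"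
    and sin0: "sin (g\<^sub>0 / 2) = s\<^sub>1 * s\<^sub>2 * tanh \<phi>"
    and cos0: "cos (g\<^sub>0 / 2) = s\<^sub>1 / cosh \<phi>"
  defines "g \<equiv> g\<^sub>0 + 2 * s\<^sub>2 * (arctan (sinh r) - arctan (sinh \<phi>))"
  shows "sin (g / 2) = s\<^sub>1 * s\<^sub>2 * tanh r" "cos (g / 2) = s\<^sub>1 / cosh r"
proof -
  define a b where "a = s\<^sub>2 * arctan (sinh \<phi>)" and "b = s\<^sub>2 * arctan (sinh r)"
  have sgn: "s\<^sub>2 = 1 \<or> s\<^sub>2 = - 1" using s by linarith
  have half: "g / 2 = g\<^sub>0 / 2 + (b - a)" by (simp add: g_def a_def b_def field_simps)
  have 0: "sin (g\<^sub>0 / 2) = s\<^sub>1 * sin a" "cos (g\<^sub>0 / 2) = s\<^sub>1 * cos a"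
    using sgn by (auto simp: sin0 cos0 a_def sin_arctan_sinh cos_arctan_sinh)
  have "sin (g / 2) = s\<^sub>1 * sin (a + (b - a))" "cos (g / 2) = s\<^sub>1 * cos (a + (b - a))"
    unfolding half sin_add cos_add 0 by (simp_all add: algebra_simps)
  then show "sin (g / 2) = s\<^sub>1 * s\<^sub>2 * tanh r" "cos (g / 2) = s\<^sub>1 / cosh r"
    using sgn by (auto simp: b_def sin_arctan_sinh cos_arctan_sinh)
qed

lemma separatrix_is_extremal:
  fixes \<phi> s\<^sub>1 s\<^sub>2 :: real
  assumes s: "\<bar>s\<^sub>1\<bar> = 1" "\<bar>s\<^sub>2\<bar> = 1"
    and sin0: "sin_half \<gamma>\<^sub>0 = s\<^sub>1 * s\<^sub>2 * tanh \<phi>"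
    and cos0: "cos_half \<gamma>\<^sub>0 = s\<^sub>1 / cosh \<phi>"
    and c0: "c\<^sub>0 / 2 = s\<^sub>2 / cosh \<phi>"
    and q: "\<And>t. t \<ge> 0 \<Longrightarrow>
      q t = (separatrix_x s\<^sub>1 \<phi> t, separatrix_y s\<^sub>2 \<phi> t, separatrix_z (s\<^sub>1 * s\<^sub>2) \<phi> t)"
  shows "extremal_trajectory (\<gamma>\<^sub>0, c\<^sub>0) q"
proof -
  obtain g\<^sub>0 where g0: "\<gamma>\<^sub>0 = angle_of g\<^sub>0"
    by (rule that, rule Quotient3_abs_rep[OF Quotient3_angle, symmetric])
  define g where "g t = g\<^sub>0 + 2 * s\<^sub>2 * (arctan (sinh (\<phi> + t)) - arctan (sinh \<phi>))" for t
  define c where "c t = 2 * s\<^sub>2 / cosh (\<phi> + t)" for t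
  have half: "sin_half (angle_of (g t)) = s\<^sub>1 * s\<^sub>2 * tanh (\<phi> + t)"
    "cos_half (angle_of (g t)) = s\<^sub>1 / cosh (\<phi> + t)" for t
    unfolding g_def sin_half.abs_eq cos_half.abs_eq
    by (rule half_angle_of_lift[OF s(2)];
        use sin0 cos0 in \<open>simp add: g0 sin_half.abs_eq cos_half.abs_eq\<close>)+
  have g': "(g has_real_derivative c t) (at t within S)" for t S
    unfolding g_def c_def
    by (rule derivative_eq_intros arctan_sinh_derivative refl)+ simp
  have angle: "has_angle_derivative (\<lambda>t. angle_of (g t)) (c t) t {0..}" for t
    unfolding has_angle_derivative_def using g' by (auto intro!: exI[of _ g])
  have c': "(c has_real_derivative - sin_angle (angle_of (g t))) (at t within {0..})" for t
  proof -
    have "s\<^sub>1 * s\<^sub>1 = 1" using s(1) by (metis abs_mult_self_eq mult_1)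
    then show ?thesis
      unfolding sin_angle_double half c_def
      by (auto intro!: derivative_eq_intros simp: tanh_def)
  qed
  have abs: "\<bar>s\<^sub>1 * s\<^sub>2\<bar> = 1" using s by (simp add: abs_mult)
  have init: "(angle_of (g 0), c 0) = (\<gamma>\<^sub>0, c\<^sub>0)"
    using c0 by (simp add: g0 g_def c_def)
  show ?thesis
    unfolding extremal_trajectory_def
    by (rule exI[of _ "\<lambda>t. angle_of (g t)"], rule exI[of _ c],
        rule exI[of _ "separatrix_x s\<^sub>1 \<phi>"], rule exI[of _ "separatrix_y s\<^sub>2 \<phi>"],
        rule exI[of _ "separatrix_z (s\<^sub>1 * s\<^sub>2) \<phi>"])
       (simp add: init q angle c' half separatrix_x_derivative[OF abs]
          separatrix_y_derivative[OF s] separatrix_z_derivative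
          del: times_divide_eq_left)
qed

section \<open>Uniqueness: integration along the separatrix\<close>

text \<open>
  The defect \<open>c / 2 - \<sigma> cos (\<gamma> / 2)\<close> solves a linear equation with integrating factor
  \<open>exp (- \<sigma> z)\<close>, so it stays zero.  Conservation of the energy alone would give
  \<open>c\<^sup>2 = 4 cos\<^sup>2 (\<gamma> / 2)\<close>, which leaves open whether the sign can change where both sides vanish.
\<close>

lemma separatrix_invariant:
  fixes \<sigma> :: real and \<gamma> :: "real \<Rightarrow> angle" and c z :: "real \<Rightarrow> real"
  assumes s: "\<bar>\<sigma>\<bar> = 1"
    and angle: "\<And>t. t \<ge> 0 \<Longrightarrow> has_angle_derivative \<gamma> (c t) t {0..}"
    and c: "\<And>t. t \<ge> 0 \<Longrightarrow> (c has_real_derivative - sin_angle (\<gamma> t)) (at t within {0..})"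
    and z: "\<And>t. t \<ge> 0 \<Longrightarrow> (z has_real_derivative sin_half (\<gamma> t)) (at t within {0..})"
    and init: "c 0 / 2 = \<sigma> * cos_half (\<gamma> 0)" "z 0 = 0"
    and "t \<ge> 0"
  shows "c t / 2 = \<sigma> * cos_half (\<gamma> t)"
proof -
  define u where "u t = c t / 2 - \<sigma> * cos_half (\<gamma> t)" for t
  have ss: "\<sigma> * \<sigma> = 1" using s by (metis abs_mult_self_eq mult_1)
  have "u t = u 0 * exp (\<sigma> * z t)"
  proof (rule linear_ode_solution[where h' = "\<lambda>t. \<sigma> * sin_half (\<gamma> t)"])
    fix t :: real assume t: "t \<ge> 0"
    have "\<sigma> * sin_half (\<gamma> t) * u t
        = \<sigma> * sin_half (\<gamma> t) * (c t / 2) - (\<sigma> * \<sigma>) * (sin_half (\<gamma> t) * cos_half (\<gamma> t))"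
      by (simp add: u_def algebra_simps)
    then have u': "\<sigma> * sin_half (\<gamma> t) * u t
        = \<sigma> * sin_half (\<gamma> t) * (c t / 2) - sin_half (\<gamma> t) * cos_half (\<gamma> t)"
      by (simp add: ss)
    show "(u has_real_derivative \<sigma> * sin_half (\<gamma> t) * u t) (at t within {0..})"
      unfolding u' unfolding u_def
      by (rule derivative_eq_intros c[OF t] has_angle_derivative_half_angles(2)[OF angle[OF t]]
           refl | simp add: t)+ (simp add: sin_angle_double)
    show "((\<lambda>t. \<sigma> * z t) has_real_derivative \<sigma> * sin_half (\<gamma> t)) (at t within {0..})"
      by (rule DERIV_cmult[OF z[OF t]])
  qed (use init \<open>t \<ge> 0\<close> in auto)
  then show ?thesis using init by (simp add: u_def)
qed

text \<open>
  With \<open>v = \<sigma> sin (\<gamma> / 2)\<close> the separatrix equations read \<open>v' = 1 - v\<^sup>2\<close> and \<open>(\<sigma> z)' = v\<close>.  The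
  Riccati equation is linearised by \<open>exp (\<sigma> z)\<close>, and \<open>exp (\<sigma> z) (1 + v)\<close>, \<open>exp (\<sigma> z) (1 - v)\<close>
  are eigenfunctions of the derivative with eigenvalues \<open>1\<close> and \<open>-1\<close>.
\<close>

lemma riccati_integral:
  fixes v h :: "real \<Rightarrow> real"
  assumes v: "\<And>t. t \<ge> 0 \<Longrightarrow> (v has_real_derivative 1 - (v t)\<^sup>2) (at t within {0..})"
    and h: "\<And>t. t \<ge> 0 \<Longrightarrow> (h has_real_derivative v t) (at t within {0..})"
    and init: "v 0 = tanh \<phi>" "h 0 = 0"
    and "t \<ge> 0"
  shows "exp (h t) = cosh (\<phi> + t) / cosh \<phi>"
proof -
  have "exp (h t) * (1 + v t) = exp (h 0) * (1 + v 0) * exp t"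
    by (rule linear_ode_solution[where h' = "\<lambda>_. 1"])
       (rule derivative_eq_intros v h refl \<open>t \<ge> 0\<close> | simp add: algebra_simps power2_eq_square)+
  moreover have "exp (h t) * (1 - v t) = exp (h 0) * (1 - v 0) * exp (- t)"
    by (rule linear_ode_solution[where h' = "\<lambda>_. - 1"])
       (rule derivative_eq_intros v h refl \<open>t \<ge> 0\<close> | simp add: algebra_simps power2_eq_square)+
  ultimately have "exp (h t) = ((1 + tanh \<phi>) * exp t + (1 - tanh \<phi>) * exp (- t)) / 2"
    by (simp add: init algebra_simps)
  also have "\<dots> = cosh t + tanh \<phi> * sinh t"
    by (simp add: cosh_def sinh_def field_simps)
  also have "\<dots> = cosh (\<phi> + t) / cosh \<phi>"
    by (simp add: cosh_add tanh_def field_simps)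
  finally show ?thesis .
qed

lemma extremal_is_separatrix:
  fixes \<phi> s\<^sub>1 s\<^sub>2 :: real
  assumes s: "\<bar>s\<^sub>1\<bar> = 1" "\<bar>s\<^sub>2\<bar> = 1"
    and sin0: "sin_half \<gamma>\<^sub>0 = s\<^sub>1 * s\<^sub>2 * tanh \<phi>"
    and cos0: "cos_half \<gamma>\<^sub>0 = s\<^sub>1 / cosh \<phi>"
    and c0: "c\<^sub>0 / 2 = s\<^sub>2 / cosh \<phi>"
    and q: "extremal_trajectory (\<gamma>\<^sub>0, c\<^sub>0) q"
    and "t \<ge> 0"
  shows "q t = (separatrix_x s\<^sub>1 \<phi> t, separatrix_y s\<^sub>2 \<phi> t, separatrix_z (s\<^sub>1 * s\<^sub>2) \<phi> t)"
proof -
  obtain \<gamma> c x y z where init: "\<gamma> 0 = \<gamma>\<^sub>0" "c 0 = c\<^sub>0" "x 0 = 0" "y 0 = 0" "z 0 = 0"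
    and qt: "\<And>t. t \<ge> 0 \<Longrightarrow> q t = (x t, y t, z t)"
    and angle: "\<And>t. t \<ge> 0 \<Longrightarrow> has_angle_derivative \<gamma> (c t) t {0..}"
    and c: "\<And>t. t \<ge> 0 \<Longrightarrow> (c has_real_derivative - sin_angle (\<gamma> t)) (at t within {0..})"
    and x: "\<And>t. t \<ge> 0 \<Longrightarrow> (x has_real_derivative cos_half (\<gamma> t) * cosh (z t)) (at t within {0..})"
    and y: "\<And>t. t \<ge> 0 \<Longrightarrow> (y has_real_derivative cos_half (\<gamma> t) * sinh (z t)) (at t within {0..})"
    and z: "\<And>t. t \<ge> 0 \<Longrightarrow> (z has_real_derivative sin_half (\<gamma> t)) (at t within {0..})"
    using q unfolding extremal_trajectory_def by (smt (verit) Pair_inject)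
  define \<sigma> where "\<sigma> = s\<^sub>1 * s\<^sub>2"
  have abs: "\<bar>\<sigma>\<bar> = 1" using s by (simp add: \<sigma>_def abs_mult)
  have ss: "\<sigma> * \<sigma> = 1" using abs by (metis abs_mult_self_eq mult_1)
  have s1: "s\<^sub>1 * s\<^sub>1 = 1" using s(1) by (metis abs_mult_self_eq mult_1)
  have "c 0 / 2 = (s\<^sub>1 * s\<^sub>1) * s\<^sub>2 / cosh \<phi>" by (simp add: init c0 s1)
  then have "c 0 / 2 = \<sigma> * cos_half (\<gamma> 0)" by (simp add: init cos0 \<sigma>_def mult_ac)
  then have ct: "c t / 2 = \<sigma> * cos_half (\<gamma> t)" if "t \<ge> 0" for t
    using separatrix_invariant[OF abs angle c z] init that by blast
  have z': "((\<lambda>t. \<sigma> * z t) has_real_derivative \<sigma> * sin_half (\<gamma> t)) (at t within {0..})"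
    if "t \<ge> 0" for t
    by (rule DERIV_cmult[OF z[OF that]])
  have v': "((\<lambda>t. \<sigma> * sin_half (\<gamma> t)) has_real_derivative 1 - (\<sigma> * sin_half (\<gamma> t))\<^sup>2) (at t within {0..})"
    if "t \<ge> 0" for t
  proof -
    have "((\<lambda>t. \<sigma> * sin_half (\<gamma> t)) has_real_derivative \<sigma> * (cos_half (\<gamma> t) * c t / 2)) (at t within {0..})"
      by (rule DERIV_cmult, rule has_angle_derivative_half_angles(1)[OF angle]) (use that in auto)
    also have "\<sigma> * (cos_half (\<gamma> t) * c t / 2) = \<sigma> * cos_half (\<gamma> t) * (c t / 2)"
      by simp
    also have "\<dots> = (\<sigma> * \<sigma>) * (cos_half (\<gamma> t))\<^sup>2"
      by (simp only: ct[OF that] power2_eq_square mult_ac)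
    also have "\<dots> = 1 - (\<sigma> * sin_half (\<gamma> t))\<^sup>2"
      using sin_half_squared_add_cos_half_squared[of "\<gamma> t"] ss
      by (simp add: power_mult_distrib power2_eq_square[of \<sigma>])
    finally show ?thesis .
  qed
  have "\<sigma> * sin_half (\<gamma> 0) = (\<sigma> * \<sigma>) * tanh \<phi>" by (simp add: init sin0 \<sigma>_def)
  then have v0: "\<sigma> * sin_half (\<gamma> 0) = tanh \<phi>" by (simp add: ss)
  have E: "exp (\<sigma> * z t) = cosh (\<phi> + t) / cosh \<phi>" if "t \<ge> 0" for t
    by (rule riccati_integral[OF v' z' v0]) (use init that in auto)
  have zt: "z t = separatrix_z \<sigma> \<phi> t" if "t \<ge> 0" for t
  proof -
    have "\<sigma> * z t = ln (cosh (\<phi> + t) / cosh \<phi>)" using E[OF that] by (metis ln_exp)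
    then have "separatrix_z \<sigma> \<phi> t = (\<sigma> * \<sigma>) * z t" by (simp add: separatrix_z_def mult.assoc)
    then show ?thesis by (simp add: ss)
  qed
  \<comment> \<open>On the separatrix \<open>cos (\<gamma> / 2)\<close> decays at the logarithmic rate \<open>\<sigma> z'\<close>, which makes its
    product with \<open>exp (\<sigma> z)\<close> constant.\<close>
  have cost: "cos_half (\<gamma> t) = s\<^sub>1 / cosh (\<phi> + t)" if "t \<ge> 0" for t
  proof -
    have "cos_half (\<gamma> t) = cos_half (\<gamma> 0) * exp (- (\<sigma> * z t))"
    proof (rule linear_ode_solution[where h' = "\<lambda>t. - (\<sigma> * sin_half (\<gamma> t))"])
      fix t :: real assume t: "t \<ge> 0"
      have "- sin_half (\<gamma> t) * c t / 2 = - (\<sigma> * sin_half (\<gamma> t)) * cos_half (\<gamma> t)"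
        using ct[OF t] by (simp only: times_divide_eq_right[symmetric]) (simp add: mult_ac)
      then show "((\<lambda>t. cos_half (\<gamma> t)) has_real_derivative
          - (\<sigma> * sin_half (\<gamma> t)) * cos_half (\<gamma> t)) (at t within {0..})"
        using has_angle_derivative_half_angles(2)[OF angle[OF t]] t by (metis atLeast_iff)
    qed (use init that z' in \<open>auto intro: DERIV_minus\<close>)
    then show ?thesis by (simp add: init cos0 exp_minus E[OF that])
  qed
  have "x t = separatrix_x s\<^sub>1 \<phi> t"
    by (rule eq_if_derivatives_eq[OF x])
       (use separatrix_x_derivative[OF abs] in \<open>auto simp: cost zt init \<open>t \<ge> 0\<close>\<close>)
  moreover have "y t = separatrix_y s\<^sub>2 \<phi> t"
    by (rule eq_if_derivatives_eq[OF y])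
       (use separatrix_y_derivative[OF s] in \<open>auto simp: cost zt init \<sigma>_def \<open>t \<ge> 0\<close>\<close>)
  ultimately show ?thesis
    using qt zt \<open>t \<ge> 0\<close> by (simp add: \<sigma>_def)
qed

section \<open>Extremal trajectories on the separatrix\<close>

theorem theorem5p3:
  fixes \<gamma>\<^sub>0 :: angle and c\<^sub>0 \<phi> k s\<^sub>1 s\<^sub>2 w :: real
    and \<phi>t :: "real \<Rightarrow> real" and q :: "real \<Rightarrow> real \<times> real \<times> real"
  assumes "(\<gamma>\<^sub>0, c\<^sub>0) \<in> C3"
    and "has_C3_coordinates (\<gamma>\<^sub>0, c\<^sub>0) \<phi> k"
    and "k = 1"
    and "s\<^sub>1 = sgn (cos_half \<gamma>\<^sub>0)"
    and "s\<^sub>2 = sgn c\<^sub>0"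
    and "\<And>t. \<phi>t t = \<phi> + t"
    and "w = cosh \<phi>"
  shows "extremal_trajectory (\<gamma>\<^sub>0, c\<^sub>0) q \<longleftrightarrow>
    (\<forall>t\<ge>0. q t =
      (s\<^sub>1 / 2 * (1 / w * (\<phi>t t - \<phi>) + w * (tanh (\<phi>t t) - tanh \<phi>)),
       s\<^sub>2 / 2 * (1 / w * (\<phi>t t - \<phi>) - w * (tanh (\<phi>t t) - tanh \<phi>)),
       - s\<^sub>1 * s\<^sub>2 * ln (w * (1 / cosh (\<phi>t t)))))"
proof -
  have "cos_half \<gamma>\<^sub>0 \<noteq> 0" "c\<^sub>0 \<noteq> 0"
    using assms(1) cos_half_nonzero_on_C3 by (auto simp: C3_def)
  then have s: "\<bar>s\<^sub>1\<bar> = 1" "\<bar>s\<^sub>2\<bar> = 1" by (simp_all add: assms(4,5) abs_sgn_eq)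
  have init: "sin_half \<gamma>\<^sub>0 = s\<^sub>1 * s\<^sub>2 * tanh \<phi>" "cos_half \<gamma>\<^sub>0 = s\<^sub>1 / cosh \<phi>"
    "c\<^sub>0 / 2 = s\<^sub>2 / cosh \<phi>"
    using assms(2,4,5) by (auto simp: has_C3_coordinates_def Let_def)
  have "- s\<^sub>1 * s\<^sub>2 * ln (w * (1 / cosh (\<phi>t t))) = separatrix_z (s\<^sub>1 * s\<^sub>2) \<phi> t" for t
    by (simp add: separatrix_z_def assms(6,7) ln_div cosh_real_pos algebra_simps)
  then have "(\<forall>t\<ge>0. q t =
      (s\<^sub>1 / 2 * (1 / w * (\<phi>t t - \<phi>) + w * (tanh (\<phi>t t) - tanh \<phi>)),
       s\<^sub>2 / 2 * (1 / w * (\<phi>t t - \<phi>) - w * (tanh (\<phi>t t) - tanh \<phi>)),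
       - s\<^sub>1 * s\<^sub>2 * ln (w * (1 / cosh (\<phi>t t))))) \<longleftrightarrow>
    (\<forall>t\<ge>0. q t = (separatrix_x s\<^sub>1 \<phi> t, separatrix_y s\<^sub>2 \<phi> t, separatrix_z (s\<^sub>1 * s\<^sub>2) \<phi> t))"
    by (simp add: separatrix_x_def separatrix_y_def assms(6,7))
  then show ?thesis
    using separatrix_is_extremal[OF s init] extremal_is_separatrix[OF s init] by blast
qed

end
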